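(* Let $w$ be a strict convex modular on a nonempty set $X$, let $x_0\in X$, and suppose that the modular space $X_w^*=X_w^*(x_0)$ is $w$-complete. Let $T:X_w^*\to X_w^*$ be a $w$-contractive map such that $$\text{for each }\lambda>0\text{ there exists an }x=x(\lambda)\in X_w^*\text{ such that }w_\lambda(x,Tx)<\infty.\qquad(\ast)$$ Then $T$ has a fixed point, i.e., $Tx_*=x_*$ for some $x_*\in X_w^*$. If, in addition, $w$ assumes only finite values on $X_w^*$ (i.e., $w_\lambda(x,y)<\infty$ for all $\lambda>0$ and $x,y\in X_w^*$), then condition $(\ast)$ is redundant (it need not be assumed), the fixed point $x_*$ of $T$ is unique, and for each $\overline{x}\in X_w^*$ the sequence of iterates $\{T^n\overline{x}\}_{n=1}^\infty$ is modular convergent to $x_*$.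
   Context: Let $X$ be a nonempty set. For a function $w:(0,\infty)\times X\times X\to[0,\infty]$ write $w_\lambda(x,y)=w(\lambda,x,y)$. Consider the conditions: (i') $w_\lambda(x,x)=0$ for all $\lambda>0$, $x\in X$; (ii) $w_\lambda(x,y)=w_\lambda(y,x)$ for all $\lambda>0$, $x,y\in X$; (i$_{\mathrm s}$) given $x,y\in X$, if there exists $\lambda>0$ (possibly depending on $x,y$) with $w_\lambda(x,y)=0$, then $x=y$; (iv) $w_{\lambda+\mu}(x,y)\le\frac{\lambda}{\lambda+\mu}w_\lambda(x,z)+\frac{\mu}{\lambda+\mu}w_\mu(y,z)$ for all $\lambda,\mu>0$, $x,y,z\in X$. The function $w$ is a strict convex modular on $X$ if it satisfies (i'), (i$_{\mathrm s}$), (ii) and (iv). Fix $x_0\in X$. The modular space is $X_w^*=X_w^*(x_0)=\{x\in X:\ \exists\,\lambda=\lambda(x)>0 \text{ such that } w_\lambda(x,x_0)<\infty\}$. A sequence $\{x_n\}\subset X_w^*$ is modular convergent ($w$-convergent) to $x\in X$ if there exists $\lambda>0$ (possibly depending on $\{x_n\}$ and $x$) such that $\lim_{n\to\infty}w_\lambda(x_n,x)=0$. $X_w^*$ is modular complete ($w$-complete) if: whenever $\{x_n\}\subset X_w^*$ and there is $\lambda>0$ with $\lim_{n,m\to\infty}w_\lambda(x_n,x_m)=0$, there exists $x\in X_w^*$ such that $\lim_{n\to\infty}w_\lambda(x_n,x)=0$ (for the same $\lambda$). A map $T:X_w^*\to X_w^*$ is modular contractive ($w$-contractive) if there exist numbers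 $0<k<1$ and $\lambda_0>0$ (possibly depending on $k$) such that $w_{k\lambda}(Tx,Ty)\le w_\lambda(x,y)$ for all $0<\lambda\le\lambda_0$ and all $x,y\in X_w^*$ (inequality in $[0,\infty]$). *)

theory Defs
  imports Complex_Main "HOL-Library.Extended_Nonnegative_Real" "HOL-Library.FuncSet"
begin

text \<open>
  A function on \<open>(0,\<infinity>) \<times> X \<times> X\<close> with values in \<open>[0,\<infinity>]\<close> is a curried function
  \<open>real \<Rightarrow> 'a \<Rightarrow> 'a \<Rightarrow> ennreal\<close> with \<open>w l x y\<close> for \<open>w\<^sub>\<lambda>(x,y)\<close>. Only its values at
  \<open>l > 0\<close> and at points of the carrier are ever constrained or used.
\<close>

definition strict_convex_modular :: "'a set \<Rightarrow> (real \<Rightarrow> 'a \<Rightarrow> 'a \<Rightarrow> ennreal) \<Rightarrow> bool" where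
  "strict_convex_modular X w \<longleftrightarrow>
     (\<forall>l>0. \<forall>x\<in>X. w l x x = 0) \<and>
     (\<forall>x\<in>X. \<forall>y\<in>X. (\<exists>l>0. w l x y = 0) \<longrightarrow> x = y) \<and>
     (\<forall>l>0. \<forall>x\<in>X. \<forall>y\<in>X. w l x y = w l y x) \<and>
     (\<forall>l>0. \<forall>m>0. \<forall>x\<in>X. \<forall>y\<in>X. \<forall>z\<in>X.
        w (l + m) x y \<le> ennreal (l / (l + m)) * w l x z + ennreal (m / (l + m)) * w m y z)"

definition modular_space :: "'a set \<Rightarrow> (real \<Rightarrow> 'a \<Rightarrow> 'a \<Rightarrow> ennreal) \<Rightarrow> 'a \<Rightarrow> 'a set" where
  "modular_space X w x0 = {x \<in> X. \<exists>l>0. w l x x0 < \<infinity>}"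

definition modular_convergent_to ::
    "'a set \<Rightarrow> (real \<Rightarrow> 'a \<Rightarrow> 'a \<Rightarrow> ennreal) \<Rightarrow> 'a \<Rightarrow> (nat \<Rightarrow> 'a) \<Rightarrow> 'a \<Rightarrow> bool" where
  "modular_convergent_to X w x0 s x \<longleftrightarrow>
     (\<forall>n. s n \<in> modular_space X w x0) \<and> x \<in> X \<and>
     (\<exists>l>0. (\<lambda>n. w l (s n) x) \<longlonglongrightarrow> 0)"

text \<open>
  The limit over the product filter is the joint limit as \<open>n, m \<rightarrow> \<infinity>\<close> independently.
  The limit point is required for the same parameter \<open>l\<close> as in the Cauchy condition.
\<close>

definition modular_complete ::
    "'a set \<Rightarrow> (real \<Rightarrow> 'a \<Rightarrow> 'a \<Rightarrow> ennreal) \<Rightarrow> 'a \<Rightarrow> bool" where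
  "modular_complete X w x0 \<longleftrightarrow>
     (\<forall>s l. (\<forall>n. s n \<in> modular_space X w x0) \<and> l > 0 \<and>
        ((\<lambda>(n, m). w l (s n) (s m)) \<longlongrightarrow> 0) (sequentially \<times>\<^sub>F sequentially) \<longrightarrow>
        (\<exists>x\<in>modular_space X w x0. (\<lambda>n. w l (s n) x) \<longlonglongrightarrow> 0))"

definition modular_contractive ::
    "'a set \<Rightarrow> (real \<Rightarrow> 'a \<Rightarrow> 'a \<Rightarrow> ennreal) \<Rightarrow> 'a \<Rightarrow> ('a \<Rightarrow> 'a) \<Rightarrow> bool" where
  "modular_contractive X w x0 T \<longleftrightarrow>
     T \<in> modular_space X w x0 \<rightarrow> modular_space X w x0 \<and>
     (\<exists>k l0. 0 < k \<and> k < 1 \<and> 0 < l0 \<and>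
        (\<forall>l. 0 < l \<and> l \<le> l0 \<longrightarrow>
          (\<forall>x\<in>modular_space X w x0. \<forall>y\<in>modular_space X w x0.
             w (k * l) (T x) (T y) \<le> w l x y)))"

end

theory Submission imports Defs begin

text \<open>
  Convexity makes \<open>\<lambda> w\<^sub>\<lambda>\<close> nonincreasing in \<open>\<lambda>\<close>, so a modular contraction satisfies
  \<open>w\<^sub>\<lambda>(Tx, Ty) \<le> k w\<^bsub>k\<lambda>\<^esub>(Tx, Ty) \<le> k w\<^sub>\<lambda>(x, y)\<close> for small \<open>\<lambda>\<close>: it is a Banach contraction for each
  single \<open>w\<^sub>\<lambda>\<close>. The missing triangle inequality is replaced by the splitting
  \<open>\<lambda> = (1 - k)\<lambda> + k\<lambda>\<close>, which bounds the whole orbit by \<open>w\<^sub>\<lambda>(x, T\<^sup>mx) \<le> w\<^bsub>(1-k)\<lambda>\<^esub>(x, Tx)\<close>. Hence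
  orbits are Cauchy for \<open>w\<^sub>\<lambda>\<close>, and a limit \<open>p\<close> has \<open>w\<^bsub>2\<lambda>\<^esub>(p, Tp) = 0\<close>.
\<close>

lemma modular_refl:
  "strict_convex_modular X w \<Longrightarrow> l > 0 \<Longrightarrow> x \<in> X \<Longrightarrow> w l x x = 0"
  unfolding strict_convex_modular_def by blast

lemma modular_sym:
  "strict_convex_modular X w \<Longrightarrow> l > 0 \<Longrightarrow> x \<in> X \<Longrightarrow> y \<in> X \<Longrightarrow> w l x y = w l y x"
  unfolding strict_convex_modular_def by blast

lemma modular_strict:
  "strict_convex_modular X w \<Longrightarrow> l > 0 \<Longrightarrow> x \<in> X \<Longrightarrow> y \<in> X \<Longrightarrow> w l x y = 0 \<Longrightarrow> x = y"
  unfolding strict_convex_modular_def by blast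

lemma modular_convex:
  assumes "strict_convex_modular X w" "l > 0" "m > 0" "x \<in> X" "y \<in> X" "z \<in> X"
  shows "w (l + m) x y \<le> ennreal (l / (l + m)) * w l x z + ennreal (m / (l + m)) * w m y z"
  using assms unfolding strict_convex_modular_def by blast

text \<open>Convexity with \<open>z = y\<close> and the splitting \<open>m = l + (m - l)\<close>:
  the second summand is a multiple of \<open>w (m - l) y y\<close>, which vanishes.\<close>

lemma modular_le_scaled:
  assumes w: "strict_convex_modular X w" and l: "0 < l" "l < m" and xy: "x \<in> X" "y \<in> X"
  shows "w m x y \<le> ennreal (l / m) * w l x y"
  using modular_convex[OF w l(1) _ xy xy(2), of "m - l"] modular_refl[OF w _ xy(2), of "m - l"] l
  by simp

lemma ennreal_mult_le_self: "c \<le> 1 \<Longrightarrow> ennreal c * a \<le> a"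
  using mult_right_mono[of "ennreal c" 1 a] by simp

text \<open>Stands in for the triangle inequality, at the price of doubling the parameter. The
  weights 1/2 are dropped because it is applied to terms that tend to 0.\<close>

lemma modular_double_le:
  assumes w: "strict_convex_modular X w" and l: "0 < l" and xyz: "x \<in> X" "y \<in> X" "z \<in> X"
  shows "w (2 * l) x y \<le> w l x z + w l y z"
proof -
  have "w (l + l) x y \<le> ennreal (l / (l + l)) * w l x z + ennreal (l / (l + l)) * w l y z"
    by (rule modular_convex[OF w l l xyz])
  also have "\<dots> = ennreal (1 / 2) * w l x z + ennreal (1 / 2) * w l y z"
    using l by simp
  also have "\<dots> \<le> w l x z + w l y z"
    by (intro add_mono ennreal_mult_le_self) auto
  finally show ?thesis by simp
qed

text \<open>Supplies the point that makes finiteness of \<open>w\<close> imply the starting-point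
  condition of the theorem.\<close>

lemma base_in_modular_space:
  "strict_convex_modular X w \<Longrightarrow> x0 \<in> X \<Longrightarrow> x0 \<in> modular_space X w x0"
  using modular_refl[of X w 1 x0] by (auto simp: modular_space_def intro: exI[of _ 1])

lemma modular_completeD:
  assumes "modular_complete X w x0" "\<And>n. s n \<in> modular_space X w x0" "l > 0"
    and "((\<lambda>(n, m). w l (s n) (s m)) \<longlongrightarrow> 0) (sequentially \<times>\<^sub>F sequentially)"
  obtains x where "x \<in> modular_space X w x0" "(\<lambda>n. w l (s n) x) \<longlonglongrightarrow> 0"
  using assms(1)[unfolded modular_complete_def, rule_format, of s l] assms(2-4) by auto

lemma tendsto_ennreal_power_mult_zero:
  assumes "0 \<le> k" "k < 1" "W < \<infinity>"
  shows "(\<lambda>n. ennreal (k ^ n) * W) \<longlonglongrightarrow> 0"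
proof -
  have "(\<lambda>n. ennreal (k ^ n)) \<longlonglongrightarrow> ennreal 0"
    using assms by (intro tendsto_ennrealI LIMSEQ_realpow_zero) auto
  then have "(\<lambda>n. W * ennreal (k ^ n)) \<longlonglongrightarrow> W * 0"
    using assms(3) by (intro ennreal_tendsto_cmult) auto
  then show ?thesis by (simp add: mult.commute)
qed

text \<open>Finiteness is essential: for \<open>k > 0\<close> the value infinity satisfies the
  inequality too.\<close>

lemma ennreal_le_contracted_imp_zero:
  fixes a :: ennreal
  assumes "0 \<le> k" "k < 1" "a \<le> ennreal k * a" "a < \<infinity>"
  shows "a = 0"
proof (cases a)
  case (real r)
  then have "r \<le> k * r"
    using assms by (simp flip: ennreal_mult)
  then have "(1 - k) * r \<le> 0" by (simp add: algebra_simps)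
  then show ?thesis using assms real by (simp add: mult_le_0_iff)
qed (use assms in auto)

text \<open>The contraction inequality is fixed at one scale \<open>L\<close>, which the theorem
  instantiates with the upper bound of the admissible scales.\<close>

locale modular_contraction =
  fixes X :: "'a set" and w :: "real \<Rightarrow> 'a \<Rightarrow> 'a \<Rightarrow> ennreal" and x0 :: 'a
    and T :: "'a \<Rightarrow> 'a" and k L :: real
  assumes modular: "strict_convex_modular X w"
    and maps_to: "x \<in> modular_space X w x0 \<Longrightarrow> T x \<in> modular_space X w x0"
    and k_pos: "0 < k" and k_less_1: "k < 1" and L_pos: "0 < L"
    and contractive: "\<lbrakk>x \<in> modular_space X w x0; y \<in> modular_space X w x0\<rbrakk>
      \<Longrightarrow> w (k * L) (T x) (T y) \<le> w L x y"
begin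

abbreviation "M \<equiv> modular_space X w x0"

lemma in_carrier: "x \<in> M \<Longrightarrow> x \<in> X"
  by (simp add: modular_space_def)

lemma funpow_in: "x \<in> M \<Longrightarrow> (T ^^ n) x \<in> M"
  by (induction n) (auto intro: maps_to)

lemma banach_contraction:
  assumes "x \<in> M" "y \<in> M"
  shows "w L (T x) (T y) \<le> ennreal k * w L x y"
proof -
  have "w L (T x) (T y) \<le> ennreal (k * L / L) * w (k * L) (T x) (T y)"
    using assms k_pos k_less_1 L_pos
    by (intro modular_le_scaled[OF modular]) (auto intro: in_carrier maps_to)
  also have "\<dots> = ennreal k * w (k * L) (T x) (T y)"
    using L_pos by simp
  also have "\<dots> \<le> ennreal k * w L x y"
    by (intro mult_left_mono contractive assms) auto
  finally show ?thesis .
qed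

lemma funpow_contraction:
  assumes "x \<in> M" "y \<in> M"
  shows "w L ((T ^^ n) x) ((T ^^ n) y) \<le> ennreal (k ^ n) * w L x y"
proof (induction n)
  case (Suc n)
  have "w L ((T ^^ Suc n) x) ((T ^^ Suc n) y) \<le> ennreal k * w L ((T ^^ n) x) ((T ^^ n) y)"
    using banach_contraction[OF funpow_in[OF assms(1)] funpow_in[OF assms(2)]] by simp
  also have "\<dots> \<le> ennreal k * (ennreal (k ^ n) * w L x y)"
    by (intro mult_left_mono Suc.IH) auto
  also have "\<dots> = ennreal (k ^ Suc n) * w L x y"
    using k_pos by (simp add: ennreal_mult mult.assoc)
  finally show ?case .
qed simp

text \<open>The induction closes with a bound uniform in \<open>m\<close> because the convexity
  weights \<open>1 - k\<close> and \<open>k\<close> add up to 1. An infinite right-hand side is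
  allowed.\<close>

lemma orbit_bound:
  assumes x: "x \<in> M"
  shows "w L x ((T ^^ m) x) \<le> w ((1 - k) * L) x (T x)"
proof (induction m)
  case 0
  then show ?case using modular_refl[OF modular L_pos in_carrier[OF x]] by simp
next
  case (Suc m)
  let ?y = "(T ^^ m) x" and ?W = "w ((1 - k) * L) x (T x)"
  have y: "?y \<in> M" by (rule funpow_in[OF x])
  have pos: "0 < (1 - k) * L" "0 < k * L"
    using k_pos k_less_1 L_pos by simp_all
  have split: "(1 - k) * L + k * L = L" by (simp add: algebra_simps)
  \<comment> \<open>The intermediate point is \<open>T x\<close>: the leg from \<open>x\<close>
    costs \<open>?W\<close>, and the other leg, at scale \<open>k * L\<close>, contracts to the
    induction hypothesis.\<close>
  have "w L x (T ?y) \<le> ennreal (1 - k) * ?W + ennreal k * w (k * L) (T ?y) (T x)"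
    using modular_convex[OF modular pos in_carrier[OF x] in_carrier[OF maps_to[OF y]]
        in_carrier[OF maps_to[OF x]]] L_pos
    unfolding split by simp
  also have "w (k * L) (T ?y) (T x) \<le> w L x ?y"
    using contractive[OF x y]
      modular_sym[OF modular pos(2) in_carrier[OF maps_to[OF y]] in_carrier[OF maps_to[OF x]]]
    by simp
  also have "\<dots> \<le> ?W" by (rule Suc.IH)
  also have "ennreal (1 - k) * ?W + ennreal k * ?W = ?W"
    using k_pos k_less_1 by (simp flip: distrib_right ennreal_plus)
  finally show ?case by (simp add: add_mono mult_left_mono)
qed

lemma orbit_cauchy:
  assumes x: "x \<in> M" and fin: "w ((1 - k) * L) x (T x) < \<infinity>"
  shows "((\<lambda>(n, m). w L ((T ^^ n) x) ((T ^^ m) x)) \<longlongrightarrow> 0) (sequentially \<times>\<^sub>F sequentially)"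
proof (rule order_tendstoI)
  fix e :: ennreal assume "0 < e"
  let ?W = "w ((1 - k) * L) x (T x)"
  have "(\<lambda>n. ennreal (k ^ n) * ?W) \<longlonglongrightarrow> 0"
    using k_pos k_less_1 fin by (intro tendsto_ennreal_power_mult_zero) auto
  from order_tendstoD(2)[OF this \<open>0 < e\<close>] obtain N
    where N: "\<And>n. n \<ge> N \<Longrightarrow> ennreal (k ^ n) * ?W < e"
    unfolding eventually_sequentially by blast
  \<comment> \<open>Splitting off the common \<open>n\<close> iterations leaves \<open>k ^ n\<close>
    times a distance from \<open>x\<close> to its orbit, bounded independently of
    \<open>m\<close>.\<close>
  have ordered: "w L ((T ^^ n) x) ((T ^^ m) x) < e" if "N \<le> n" "n \<le> m" for n m
  proof -
    have "w L ((T ^^ n) x) ((T ^^ m) x) = w L ((T ^^ n) x) ((T ^^ n) ((T ^^ (m - n)) x))"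
      using that by (simp flip: funpow_add[THEN fun_cong, unfolded comp_def])
    also have "\<dots> \<le> ennreal (k ^ n) * w L x ((T ^^ (m - n)) x)"
      by (intro funpow_contraction funpow_in x)
    also have "\<dots> \<le> ennreal (k ^ n) * ?W"
      by (intro mult_left_mono orbit_bound x) auto
    also have "\<dots> < e" using that by (intro N)
    finally show ?thesis .
  qed
  have "w L ((T ^^ n) x) ((T ^^ m) x) < e" if "N \<le> n" "N \<le> m" for n m
    using that ordered[of n m] ordered[of m n]
      modular_sym[OF modular L_pos, of "(T ^^ n) x" "(T ^^ m) x"] funpow_in[OF x] in_carrier
    by (cases "n \<le> m") auto
  then show "\<forall>\<^sub>F p in sequentially \<times>\<^sub>F sequentially.
      (case p of (n, m) \<Rightarrow> w L ((T ^^ n) x) ((T ^^ m) x)) < e"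
    unfolding eventually_prod_sequentially by auto
qed auto

lemma orbit_limit_is_fixed:
  assumes x: "x \<in> M" and p: "p \<in> M" and lim: "(\<lambda>n. w L ((T ^^ n) x) p) \<longlonglongrightarrow> 0"
  shows "T p = p"
proof -
  \<comment> \<open>The route from \<open>T p\<close> to \<open>p\<close> passes through the next
    iterate. The left side does not depend on \<open>n\<close>, and both terms on the right tend to
    0.\<close>
  have bound: "w (2 * L) (T p) p \<le> w L ((T ^^ n) x) p + w L ((T ^^ Suc n) x) p" for n
  proof -
    let ?y = "(T ^^ n) x"
    have y: "?y \<in> M" by (rule funpow_in[OF x])
    note X = in_carrier[OF maps_to[OF p]] in_carrier[OF p] in_carrier[OF maps_to[OF y]]
    have "w L (T p) (T ?y) \<le> ennreal k * w L ?y p"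
      using banach_contraction[OF y p] modular_sym[OF modular L_pos X(1,3)] by simp
    also have "\<dots> \<le> w L ?y p"
      using k_less_1 by (intro ennreal_mult_le_self) auto
    finally show ?thesis
      using modular_double_le[OF modular L_pos X] modular_sym[OF modular L_pos X(2,3)]
      by (auto intro: order_trans add_right_mono)
  qed
  have "(\<lambda>n. w L ((T ^^ n) x) p + w L ((T ^^ Suc n) x) p) \<longlonglongrightarrow> 0"
    using tendsto_add[OF lim LIMSEQ_Suc[OF lim]] by simp
  then have "w (2 * L) (T p) p \<le> 0"
    using bound by (intro LIMSEQ_le_const) auto
  \<comment> \<open>Strictness accepts a zero at any positive parameter, so the doubled scale does
    no harm.\<close>
  then show ?thesis
    using L_pos modular_strict[OF modular, of "2 * L" "T p" p] in_carrier p maps_to by auto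
qed

text \<open>Completeness yields a limit for the same parameter \<open>L\<close> as in the Cauchy
  condition, as \<open>orbit_limit_is_fixed\<close> requires.\<close>

lemma fixed_point_exists:
  assumes "modular_complete X w x0" and x: "x \<in> M" and "w ((1 - k) * L) x (T x) < \<infinity>"
  shows "\<exists>p\<in>M. T p = p"
proof -
  obtain p where "p \<in> M" "(\<lambda>n. w L ((T ^^ n) x) p) \<longlonglongrightarrow> 0"
    by (rule modular_completeD[OF assms(1) funpow_in[OF x] L_pos orbit_cauchy[OF x assms(3)]])
  then show ?thesis using orbit_limit_is_fixed[OF x] by blast
qed

lemma fixed_point_unique:
  assumes "p \<in> M" "q \<in> M" "T p = p" "T q = q" "w L q p < \<infinity>"
  shows "q = p"
proof -
  have "w L q p = 0"
    using banach_contraction[OF assms(2,1)] assms(3-5) k_pos k_less_1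
    by (intro ennreal_le_contracted_imp_zero[of k]) auto
  then show ?thesis
    using modular_strict[OF modular L_pos] in_carrier assms(1,2) by blast
qed

text \<open>Since \<open>p\<close> is fixed by every iterate, the contraction estimate for iterates
  bounds the distance to \<open>p\<close> geometrically.\<close>

lemma iterates_converge:
  assumes "p \<in> M" "T p = p" "x \<in> M" "w L x p < \<infinity>"
  shows "modular_convergent_to X w x0 (\<lambda>n. (T ^^ Suc n) x) p"
proof -
  have fix_pow: "(T ^^ n) p = p" for n
    by (induction n) (simp_all add: assms(2))
  have bound: "w L ((T ^^ n) x) p \<le> ennreal (k ^ n) * w L x p" for n
    using funpow_contraction[OF assms(3,1), of n] by (simp add: fix_pow)
  have "(\<lambda>n. ennreal (k ^ n) * w L x p) \<longlonglongrightarrow> 0"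
    using k_pos k_less_1 assms(4) by (intro tendsto_ennreal_power_mult_zero) auto
  then have "(\<lambda>n. w L ((T ^^ n) x) p) \<longlonglongrightarrow> 0"
    by (rule tendsto_sandwich[OF _ _ tendsto_const, rotated 2]) (simp_all add: bound)
  from LIMSEQ_Suc[OF this] show ?thesis
    unfolding modular_convergent_to_def
    using L_pos funpow_in[OF assms(3)] in_carrier[OF assms(1)] by blast
qed

end

theorem theorem5p3:
  fixes X :: "'a set"
    and w :: "real \<Rightarrow> 'a \<Rightarrow> 'a \<Rightarrow> ennreal"
    and x0 :: 'a
    and T :: "'a \<Rightarrow> 'a"
  assumes "X \<noteq> {}"
    and "strict_convex_modular X w"
    and "x0 \<in> X"
    and "modular_complete X w x0"
    and "modular_contractive X w x0 T"
  shows "((\<forall>l>0. \<exists>x\<in>modular_space X w x0. w l x (T x) < \<infinity>) \<longrightarrow>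
            (\<exists>x\<in>modular_space X w x0. T x = x)) \<and>
         ((\<forall>l>0. \<forall>x\<in>modular_space X w x0. \<forall>y\<in>modular_space X w x0. w l x y < \<infinity>) \<longrightarrow>
            (\<exists>p\<in>modular_space X w x0. T p = p \<and>
               (\<forall>q\<in>modular_space X w x0. T q = q \<longrightarrow> q = p) \<and>
               (\<forall>x\<in>modular_space X w x0.
                  modular_convergent_to X w x0 (\<lambda>n. (T ^^ Suc n) x) p)))"
proof -
  from assms(5) obtain k L where "T \<in> modular_space X w x0 \<rightarrow> modular_space X w x0"
    and "0 < k" "k < 1" "0 < L"
    and "\<And>l x y. \<lbrakk>0 < l; l \<le> L; x \<in> modular_space X w x0; y \<in> modular_space X w x0\<rbrakk>
      \<Longrightarrow> w (k * l) (T x) (T y) \<le> w l x y"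
    unfolding modular_contractive_def by metis
  then interpret modular_contraction X w x0 T k L
    using assms(2) by unfold_locales auto
  have pos: "0 < (1 - k) * L" using k_less_1 L_pos by simp
  \<comment> \<open>The condition is applied at the parameter \<open>(1 - k) * L\<close>, the scale
    occurring in \<open>orbit_bound\<close>.\<close>
  have exists: "\<exists>p\<in>M. T p = p" if "\<forall>l>0. \<exists>x\<in>M. w l x (T x) < \<infinity>"
    using that pos fixed_point_exists[OF assms(4)] by blast
  have "\<exists>p\<in>M. T p = p \<and> (\<forall>q\<in>M. T q = q \<longrightarrow> q = p) \<and>
      (\<forall>x\<in>M. modular_convergent_to X w x0 (\<lambda>n. (T ^^ Suc n) x) p)"
    if fin: "\<forall>l>0. \<forall>x\<in>M. \<forall>y\<in>M. w l x y < \<infinity>"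
  proof -
    have "\<forall>l>0. \<exists>x\<in>M. w l x (T x) < \<infinity>"
      using fin base_in_modular_space[OF assms(2,3)] maps_to by blast
    then obtain p where p: "p \<in> M" "T p = p" using exists by blast
    moreover have "q = p" if "q \<in> M" "T q = q" for q
      by (rule fixed_point_unique) (use fin L_pos p that in auto)
    moreover have "modular_convergent_to X w x0 (\<lambda>n. (T ^^ Suc n) x) p" if "x \<in> M" for x
      by (rule iterates_converge) (use fin L_pos p that in auto)
    ultimately show ?thesis by blast
  qed
  with exists show ?thesis by blast
qed

end
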